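(* Let $Q$ be a measure on the real line with support $I$, generating a one-dimensional exponential family with non-empty canonical parameter space $\Gamma^{\text{can}}$. Assume that $\mu_{\inf}\in\mathbb{R}$ is the left end point of $I$. Suppose that for some $\varepsilon>0$, $Q$ has on the interval $(\mu_{\inf},\mu_{\inf}+\varepsilon)$ the density $$f(x)=(x-\mu_{\inf})^{\gamma-1}g(x)$$ with respect to Lebesgue measure, where $\gamma\in\mathbb{R}$, $g$ is an analytic function (on a neighbourhood of $[\mu_{\inf},\mu_{\inf}+\varepsilon)$), and $g(\mu_{\inf})>0$. Then the left end of the interval $I$ gives a finite contribution to the Jeffreys integral if and only if $Q$ has a point mass at $\mu_{\inf}$, i.e. $Q(\{\mu_{\inf}\})>0$.
   Context: Exponential family. $Q$ is a nonzero $\sigma$-finite measure on $\mathbb{R}$, $Z(\beta)=\int e^{\beta x}\,dQ(x)$, $\Gamma^{\text{can}}=\{\beta\in\mathbb{R}: Z(\beta)<\infty\}$ and $\beta_{\inf}=\inf\Gamma^{\text{can}}$. For $\beta\in\Gamma^{\text{can}}$, $P_\beta$ is the probability measure with $\frac{dP_\beta}{dQ}(x)=\frac{1}{Z(\beta)}e^{\beta x}$. $\mu_\beta$ denotes the mean value of $P_\beta$, and $\mu_{\inf}$ denotes the infimum of the mean values $\mu_\beta$. Jeffreys integral. $I_\beta$ is the Fisher information in the canonical parametrization, i.e. the variance of $P_\beta$. With $V(\mu)$ the variance of the element of the family with mean $\mu$ and $M$ the set of mean values, the Jeffreys integral is $J=\int_{\Gamma^{\text{can}}}I_\beta^{1/2}\,d\beta=\int_M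 V(\mu)^{-1/2}\,d\mu$. "The left end of the interval $I$ gives a finite contribution to the Jeffreys integral" means that, for $\beta_1$ in the interior of $\Gamma^{\text{can}}$ (equivalently for one or for all such $\beta_1$), $\int_{\beta_{\inf}}^{\beta_1}I_\beta^{1/2}\,d\beta<\infty$. Equivalently, $\int_{\mu_{\inf}}^{\mu_{\beta_1}}V(\mu)^{-1/2}\,d\mu<\infty$. *)

theory Defs
  imports "HOL-Probability.Probability"
begin

text \<open>The topological support. Replacing it by its convex hull does not change its
  left end point (infimum).\<close>

definition measure_support :: "real measure \<Rightarrow> real set" where
  "measure_support Q = {x. \<forall>U. open U \<longrightarrow> x \<in> U \<longrightarrow> emeasure Q U > 0}"

definition partition_fun :: "real measure \<Rightarrow> real \<Rightarrow> ennreal" where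
  "partition_fun Q \<beta> = (\<integral>\<^sup>+ x. ennreal (exp (\<beta> * x)) \<partial>Q)"

definition can_params :: "real measure \<Rightarrow> real set" where
  "can_params Q = {\<beta>. partition_fun Q \<beta> < \<infinity>}"

definition beta_inf :: "real measure \<Rightarrow> ereal" where
  "beta_inf Q = Inf (ereal ` can_params Q)"

definition exp_family :: "real measure \<Rightarrow> real \<Rightarrow> real measure" where
  "exp_family Q \<beta> = density Q (\<lambda>x. ennreal (exp (\<beta> * x)) / partition_fun Q \<beta>)"

definition exp_mean :: "real measure \<Rightarrow> real \<Rightarrow> real" where
  "exp_mean Q \<beta> = (\<integral>x. x \<partial>exp_family Q \<beta>)"

text \<open>The Bochner integral of a non-integrable function is \<open>0\<close>; the integrability
  condition prevents this default from being counted as a mean value at a boundary point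
  of the parameter space where the mean is infinite or undefined.\<close>

definition mean_values :: "real measure \<Rightarrow> real set" where
  "mean_values Q =
     {exp_mean Q \<beta> | \<beta>. \<beta> \<in> can_params Q \<and> integrable (exp_family Q \<beta>) (\<lambda>x. x)}"

definition mu_inf :: "real measure \<Rightarrow> ereal" where
  "mu_inf Q = Inf (ereal ` mean_values Q)"

definition fisher_information :: "real measure \<Rightarrow> real \<Rightarrow> real" where
  "fisher_information Q \<beta> = (\<integral>x. (x - exp_mean Q \<beta>)\<^sup>2 \<partial>exp_family Q \<beta>)"

text \<open>Used only for \<open>\<beta>\<^sub>1\<close> in the interior of the parameter space. The parameter space is
  an interval, so the domain of integration then lies in that interior as well, where
  all moments are finite.\<close>

definition left_jeffreys_integral :: "real measure \<Rightarrow> real \<Rightarrow> ennreal" where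
  "left_jeffreys_integral Q \<beta>\<^sub>1 =
     (\<integral>\<^sup>+ \<beta> \<in> einterval (beta_inf Q) (ereal \<beta>\<^sub>1).
        ennreal (sqrt (fisher_information Q \<beta>)) \<partial>lborel)"

text \<open>The first conjunct excludes the case in which the second holds vacuously.\<close>

definition left_end_finite_contribution :: "real measure \<Rightarrow> bool" where
  "left_end_finite_contribution Q \<longleftrightarrow>
     interior (can_params Q) \<noteq> {} \<and>
     (\<forall>\<beta>\<^sub>1 \<in> interior (can_params Q). left_jeffreys_integral Q \<beta>\<^sub>1 < \<infinity>)"

definition has_lebesgue_density_on ::
    "real measure \<Rightarrow> (real \<Rightarrow> real) \<Rightarrow> real set \<Rightarrow> bool" where
  "has_lebesgue_density_on Q f A \<longleftrightarrow>
     f \<in> borel_measurable (restrict_space lborel A) \<and> (\<forall>x\<in>A. 0 \<le> f x) \<and>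
     restrict_space Q A = density (restrict_space lborel A) (\<lambda>x. ennreal (f x))"

text \<open>Real analyticity at every point of \<open>S\<close>. A power series expansion about a point is
  valid on a neighbourhood of it, so this is analyticity on an open neighbourhood of \<open>S\<close>.\<close>

definition real_analytic_on :: "(real \<Rightarrow> real) \<Rightarrow> real set \<Rightarrow> bool" where
  "real_analytic_on g S \<longleftrightarrow> (\<forall>x\<in>S. \<exists>F. (\<lambda>h. g (x + h)) has_fps_expansion F)"

end

theory Submission
  imports Defs
begin

text \<open>Replacing \<open>Q\<close> by the tilted measure \<open>R = exp (b x) dQ\<close> for a parameter \<open>b\<close> makes it finite, so that
  the Jeffreys integral concerns the Laplace weights \<open>exp (- s (x - m)) dR\<close> as \<open>s \<rightarrow> \<infinity>\<close>, and \<open>R\<close> still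
  has a density comparable to \<open>(x - m) powr (\<gamma> - 1)\<close> near \<open>m\<close>; finiteness forces \<open>\<gamma> > 0\<close>. With a point
  mass at \<open>m\<close> the normalising constant stays bounded away from \<open>0\<close>, and the second moment about \<open>m\<close>
  gives a variance of order at most \<open>s powr (- 2 - \<gamma> / 2)\<close>, whose square root is integrable at infinity.
  Without a point mass the normalising constant is at most of order \<open>s powr - \<gamma>\<close>, and the part of the
  measure at distances of order \<open>1 / s\<close> from \<open>m\<close> forces a variance of order at least \<open>1 / s\<^sup>2\<close>, whose
  square root is not integrable.\<close>

section \<open>Powers against exponentials, and power integrals at both ends of the
  half-line\<close>

text \<open>This is \<open>v \<le> exp v\<close> at \<open>v = u / p\<close>, raised to the power
  \<open>p\<close>. The constant is cruder than the maximum of the left side, but it depends on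
  \<open>p\<close> alone, which suffices for rates in \<open>s\<close> after scaling.\<close>

lemma powr_mult_exp_le:
  fixes p u :: real
  assumes "p > 0" "u \<ge> 0"
  shows "u powr p * exp (- u) \<le> p powr p"
proof (cases "u = 0")
  case False
  have "u / p \<le> exp (u / p)"
    using exp_ge_add_one_self[of "u / p"] by linarith
  then have "(u / p) powr p \<le> exp (u / p) powr p"
    using assms by (intro powr_mono2) auto
  also have "\<dots> = exp u"
    using assms by (simp add: powr_def)
  finally have "u powr p / p powr p \<le> exp u"
    using assms by (simp add: powr_divide)
  then show ?thesis
    using assms by (simp add: exp_minus field_simps)
qed (use assms in auto)

lemma powr_mult_exp_scaled_le:
  fixes p s y :: real
  assumes "p > 0" "s > 0" "y \<ge> 0"
  shows "y powr p * exp (- s * y) \<le> p powr p * s powr - p"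
  using powr_mult_exp_le[of p "s * y"] assms
  by (simp add: powr_mult powr_minus field_simps)

lemma nn_integral_inverse_Icc:
  fixes a b :: real
  assumes "0 < a" "a \<le> b"
  shows "(\<integral>\<^sup>+x. ennreal (1 / x) * indicator {a..b} x \<partial>lborel) = ennreal (ln b - ln a)"
  using assms by (intro nn_integral_FTC_Icc) (auto intro!: derivative_eq_intros)

lemma nn_integral_inverse_at_0:
  fixes d :: real
  assumes "d > 0"
  shows "(\<integral>\<^sup>+x. ennreal (1 / x) * indicator {0<..<d} x \<partial>lborel) = \<infinity>"
proof (rule ccontr)
  let ?I = "\<integral>\<^sup>+x. ennreal (1 / x) * indicator {0<..<d} x \<partial>lborel"
  assume "?I \<noteq> \<infinity>"
  then obtain r where r: "r \<ge> 0" "?I = ennreal r"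
    by (cases ?I) auto
  \<comment> \<open>Chosen so that the integral over \<open>{a..d/2}\<close> is exactly
    \<open>r + 1\<close>, more than the supposed value \<open>r\<close> of the whole
    integral.\<close>
  define a where "a = exp (ln (d / 2) - (r + 1))"
  have a: "0 < a" "a \<le> d / 2"
  proof -
    have "a \<le> exp (ln (d / 2))"
      unfolding a_def using r by (simp only: exp_le_cancel_iff)
    then show "a \<le> d / 2" using assms by simp
  qed (simp add: a_def)
  have "ennreal (r + 1) = ennreal (ln (d / 2) - ln a)"
    by (simp add: a_def)
  also have "\<dots> = (\<integral>\<^sup>+x. ennreal (1 / x) * indicator {a..d/2} x \<partial>lborel)"
    using nn_integral_inverse_Icc[OF a] by simp
  also have "\<dots> \<le> ?I"
    using a assms by (intro nn_integral_mono) (auto split: split_indicator)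
  finally show False using r by simp
qed

lemma nn_integral_inverse_at_top:
  fixes d :: real
  assumes "d > 0"
  shows "(\<integral>\<^sup>+x. ennreal (1 / x) * indicator {d<..} x \<partial>lborel) = \<infinity>"
proof (rule ccontr)
  let ?I = "\<integral>\<^sup>+x. ennreal (1 / x) * indicator {d<..} x \<partial>lborel"
  assume "?I \<noteq> \<infinity>"
  then obtain r where r: "r \<ge> 0" "?I = ennreal r"
    by (cases ?I) auto
  \<comment> \<open>Chosen so that the integral over \<open>{2*d..b}\<close> is exactly
    \<open>r + 1\<close>.\<close>
  define b where "b = exp (ln (2 * d) + (r + 1))"
  have b: "2 * d \<le> b"
  proof -
    have "exp (ln (2 * d)) \<le> b"
      unfolding b_def using r by (simp only: exp_le_cancel_iff)
    then show ?thesis using assms by simp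
  qed
  have "ennreal (r + 1) = ennreal (ln b - ln (2 * d))"
    by (simp add: b_def)
  also have "\<dots> = (\<integral>\<^sup>+x. ennreal (1 / x) * indicator {2*d..b} x \<partial>lborel)"
    using nn_integral_inverse_Icc[OF _ b] assms by simp
  also have "\<dots> \<le> ?I"
    using assms by (intro nn_integral_mono) (auto split: split_indicator)
  finally show False using r by simp
qed

lemma nn_integral_powr_at_0:
  fixes q d :: real
  assumes "q > 0" "d > 0"
  shows "(\<integral>\<^sup>+x. ennreal (x powr (q - 1)) * indicator {0<..<d} x \<partial>lborel) < \<infinity>"
proof -
  have "((\<lambda>x. x powr (q - 1)) has_integral (d powr (q - 1 + 1) / (q - 1 + 1))) {0..d}"
    using has_integral_powr_from_0[of "q - 1" d] assms by simp
  from nn_integral_has_integral_lebesgue'[OF _ this]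
  have "(\<integral>\<^sup>+x. ennreal (x powr (q - 1)) * indicator {0..d} x \<partial>lborel)
      = ennreal (d powr (q - 1 + 1) / (q - 1 + 1))"
    by simp
  moreover have "(\<integral>\<^sup>+x. ennreal (x powr (q - 1)) * indicator {0<..<d} x \<partial>lborel)
      \<le> (\<integral>\<^sup>+x. ennreal (x powr (q - 1)) * indicator {0..d} x \<partial>lborel)"
    by (intro nn_integral_mono) (auto split: split_indicator)
  ultimately show ?thesis
    by (metis ennreal_less_top infinity_ennreal_def le_less_trans)
qed

lemma nn_integral_powr_at_top:
  fixes r d :: real
  assumes "r > 0" "d > 0"
  shows "(\<integral>\<^sup>+x. ennreal (x powr (- 1 - r)) * indicator {d<..} x \<partial>lborel) < \<infinity>"
proof -
  have "((\<lambda>x. x powr (- 1 - r)) has_integral - (d powr (- 1 - r + 1)) / (- 1 - r + 1)) {d..}"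
    using assms by (intro has_integral_powr_to_inf) auto
  from nn_integral_has_integral_lebesgue'[OF _ this]
  have "(\<integral>\<^sup>+x. ennreal (x powr (- 1 - r)) * indicator {d..} x \<partial>lborel)
      = ennreal (- (d powr (- 1 - r + 1)) / (- 1 - r + 1))"
    by simp
  moreover have "(\<integral>\<^sup>+x. ennreal (x powr (- 1 - r)) * indicator {d<..} x \<partial>lborel)
      \<le> (\<integral>\<^sup>+x. ennreal (x powr (- 1 - r)) * indicator {d..} x \<partial>lborel)"
    by (intro nn_integral_mono) (auto split: split_indicator)
  ultimately show ?thesis
    by (metis ennreal_less_top infinity_ennreal_def le_less_trans)
qed

text \<open>The Gamma integral under the substitution of \<open>s * x\<close> for its variable; this
  is the source of the rate \<open>s powr - q\<close>.\<close>

lemma nn_integral_powr_exp_scaled: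
  fixes q s :: real
  assumes "q > 0" "s > 0"
  shows "(\<integral>\<^sup>+x. ennreal (x powr (q - 1) * exp (- s * x)) * indicator {0<..} x \<partial>lborel)
    \<le> ennreal (Gamma q * s powr - q)"
proof -
  let ?f = "\<lambda>x. ennreal (indicator {0..} x * x powr (q - 1) / exp x)"
  have "ennreal (Gamma q * s powr - q) = ennreal (s powr - q) * integral\<^sup>N lborel ?f"
    using Gamma_conv_nn_integral_real[OF assms(1)] assms
    by (simp add: ennreal_mult'' mult.commute Gamma_real_pos less_imp_le)
  also have "integral\<^sup>N lborel ?f = ennreal \<bar>s\<bar> * (\<integral>\<^sup>+x. ?f (0 + s * x) \<partial>lborel)"
    using assms by (intro nn_integral_real_affine) auto
  also have "ennreal (s powr - q) * \<dots> = (\<integral>\<^sup>+x. ennreal (s powr - q) * (ennreal \<bar>s\<bar> * ?f (0 + s * x)) \<partial>lborel)"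
    by (simp add: nn_integral_cmult)
  finally have *: "ennreal (Gamma q * s powr - q)
      = (\<integral>\<^sup>+x. ennreal (s powr - q) * (ennreal \<bar>s\<bar> * ?f (0 + s * x)) \<partial>lborel)" .
  have "x powr (q - 1) * exp (- s * x) = s powr - q * (s * ((s * x) powr (q - 1) / exp (s * x)))"
    if "x > 0" for x
  proof -
    have "s powr - q * s * s powr (q - 1) = 1"
    proof -
      have "s powr - q * s powr 1 * s powr (q - 1) = s powr (- q + 1 + (q - 1))"
        by (simp only: powr_add)
      then show ?thesis using assms by simp
    qed
    moreover have "s powr - q * (s * ((s * x) powr (q - 1) / exp (s * x)))
        = (s powr - q * s * s powr (q - 1)) * (x powr (q - 1) * exp (- s * x))"
      using that assms by (simp add: powr_mult exp_minus divide_inverse)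
    ultimately show ?thesis by simp
  qed
  then show ?thesis
    unfolding * using assms
    by (intro nn_integral_mono) (auto split: split_indicator simp: ennreal_mult''[symmetric])
qed

section \<open>Exponential families of finite measures on a half-line\<close>

lemma sets_exp_family [simp, measurable_cong]: "sets (exp_family Q \<beta>) = sets Q"
  by (simp add: exp_family_def)

lemma space_exp_family [simp]: "space (exp_family Q \<beta>) = space Q"
  by (simp add: exp_family_def)

text \<open>The exponential absorbs \<open>y powr (2 + p)\<close> and leaves
  \<open>y powr (- p)\<close>. A finite negative moment is thereby traded for a second moment
  decaying faster than \<open>s powr - 2\<close>. At \<open>y = 0\<close> both sides vanish, since
  \<open>0 powr (- p) = 0\<close>.\<close>

lemma power2_mult_exp_le:
  fixes s y p :: real
  assumes "s > 0" "p > 0" "y \<ge> 0"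
  shows "exp (- s * y) * y\<^sup>2 \<le> (2 + p) powr (2 + p) * s powr (- (2 + p)) * y powr (- p)"
proof (cases "y = 0")
  case False
  then have "y powr (2 + p) * y powr (- p) = y\<^sup>2"
    using assms by (simp add: powr_add[symmetric])
  then have "exp (- s * y) * y\<^sup>2 = y powr (2 + p) * exp (- s * y) * y powr (- p)"
    by (metis mult.commute mult.assoc)
  also have "\<dots> \<le> (2 + p) powr (2 + p) * s powr (- (2 + p)) * y powr (- p)"
    using assms by (intro mult_right_mono powr_mult_exp_scaled_le) auto
  finally show ?thesis .
qed auto

text \<open>To be applied to a tilt of \<open>Q\<close>. Finiteness puts every parameter
  \<open>- s\<close> with \<open>s \<ge> 0\<close> into the parameter space, and the left tail of
  the Jeffreys integral becomes the regime of large \<open>s\<close>.\<close>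

locale left_bounded_measure = finite_measure R for R :: "real measure" +
  fixes m :: real
  assumes sets_R [simp, measurable_cong]: "sets R = sets borel"
    and AE_ge: "AE x in R. m \<le> x"
    and nonzero: "emeasure R (space R) \<noteq> 0"
begin

lemma space_R [simp]: "space R = UNIV"
  using sets_eq_imp_space_eq[OF sets_R] by simp

text \<open>The Laplace transform centred at \<open>m\<close>: for \<open>s \<ge> 0\<close> the
  weight is at most 1 almost everywhere and equals 1 at \<open>m\<close>, so a point mass there
  bounds \<open>Lap s\<close> from below.\<close>

definition Lap :: "real \<Rightarrow> ennreal" where
  "Lap s = (\<integral>\<^sup>+x. ennreal (exp (- s * (x - m))) \<partial>R)"

text \<open>\<open>Lap s\<close> and the partition function differ by the factor
  \<open>exp (- s * m)\<close>, which is positive and finite and therefore cancels. Nonnegative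
  integrals make the formula available before any moment is known to be finite.\<close>

lemma nn_integral_exp_family:
  assumes [measurable]: "h \<in> borel_measurable borel"
  shows "(\<integral>\<^sup>+x. h x \<partial>exp_family R (- s)) = (\<integral>\<^sup>+x. ennreal (exp (- s * (x - m))) * h x \<partial>R) / Lap s"
proof -
  define c where "c = ennreal (exp (- s * m))"
  define w where "w x = ennreal (exp (- s * (x - m)))" for x
  have [measurable]: "w \<in> borel_measurable borel"
    unfolding w_def by measurable
  have c: "c \<noteq> 0" "c \<noteq> \<infinity>"
    by (simp_all add: c_def ennreal_eq_0_iff not_le)
  have e: "ennreal (exp (- s * x)) = w x * c" for x
    by (simp add: c_def w_def ennreal_mult''[symmetric] exp_add[symmetric] algebra_simps)
  have L: "Lap s = (\<integral>\<^sup>+x. w x \<partial>R)"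
    by (simp add: Lap_def w_def)
  have p: "partition_fun R (- s) = Lap s * c"
    unfolding partition_fun_def L e by (simp add: nn_integral_multc)
  have "exp_family R (- s) = density R (\<lambda>x. w x / Lap s)"
    unfolding exp_family_def p e using c by (simp add: divide_mult_eq)
  then have "(\<integral>\<^sup>+x. h x \<partial>exp_family R (- s)) = (\<integral>\<^sup>+x. w x / Lap s * h x \<partial>R)"
    by (simp add: nn_integral_density)
  also have "\<dots> = (\<integral>\<^sup>+x. (w x * h x) / Lap s \<partial>R)"
    by (simp add: divide_ennreal_def ac_simps)
  also have "\<dots> = (\<integral>\<^sup>+x. w x * h x \<partial>R) / Lap s"
    by (intro nn_integral_divide) measurable
  finally show ?thesis by (simp add: w_def)
qed

lemma nn_integral_less_top_of_bounded:
  assumes "\<And>x. m \<le> x \<Longrightarrow> f x \<le> ennreal K"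
  shows "(\<integral>\<^sup>+x. f x \<partial>R) < \<infinity>"
proof -
  have "(\<integral>\<^sup>+x. f x \<partial>R) \<le> (\<integral>\<^sup>+x. ennreal K \<partial>R)"
    using AE_ge assms by (intro nn_integral_mono_AE) auto
  also have "\<dots> < \<infinity>"
    by (simp add: ennreal_mult_eq_top_iff emeasure_finite less_top[symmetric])
  finally show ?thesis .
qed

lemma Lap_less_top: "s \<ge> 0 \<Longrightarrow> Lap s < \<infinity>"
  unfolding Lap_def by (rule nn_integral_less_top_of_bounded[of _ 1]) auto

lemma Lap_pos: "Lap s > 0"
proof -
  have "\<not> (AE x in R. ennreal (exp (- s * (x - m))) = 0)"
  proof
    assume "AE x in R. ennreal (exp (- s * (x - m))) = 0"
    then have "AE x in R. False"
      by eventually_elim (simp add: ennreal_eq_0_iff not_le)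
    then show False
      using nonzero ae_filter_eq_bot_iff[of R] by (simp add: trivial_limit_def)
  qed
  then have "Lap s \<noteq> 0" unfolding Lap_def by (subst nn_integral_0_iff_AE) auto
  then show ?thesis by (simp add: zero_less_iff_neq_zero)
qed

lemma prob_space_exp_family:
  assumes "s \<ge> 0"
  shows "prob_space (exp_family R (- s))"
proof
  have "emeasure (exp_family R (- s)) (space (exp_family R (- s))) = (\<integral>\<^sup>+x. 1 \<partial>exp_family R (- s))"
    by simp
  also have "\<dots> = Lap s / Lap s"
    by (subst nn_integral_exp_family) (auto simp: Lap_def)
  also have "\<dots> = 1"
    using Lap_less_top[OF assms] Lap_pos[of s] by (intro ennreal_divide_self) auto
  finally show "emeasure (exp_family R (- s)) (space (exp_family R (- s))) = 1" .
qed

lemma integrable_exp_family_square: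
  assumes "s > 0"
  shows "integrable (exp_family R (- s)) (\<lambda>x. (x - m)\<^sup>2)"
proof (rule integrableI_bounded)
  have "(\<integral>\<^sup>+x. ennreal (exp (- s * (x - m))) * ennreal ((x - m)\<^sup>2) \<partial>R) < \<infinity>"
  proof (rule nn_integral_less_top_of_bounded)
    fix x :: real assume "m \<le> x"
    then have "(x - m) powr 2 * exp (- s * (x - m)) \<le> 2 powr 2 * s powr - 2"
      using assms by (intro powr_mult_exp_scaled_le) auto
    then show "ennreal (exp (- s * (x - m))) * ennreal ((x - m)\<^sup>2) \<le> ennreal (2 powr 2 * s powr - 2)"
      using \<open>m \<le> x\<close> by (simp add: ennreal_mult''[symmetric] powr_numeral mult.commute)
  qed
  then show "(\<integral>\<^sup>+x. ennreal (norm ((x - m)\<^sup>2)) \<partial>exp_family R (- s)) < \<infinity>"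
    using Lap_pos[of s] by (subst nn_integral_exp_family) (auto simp: divide_less_ennreal ennreal_divide_eq_top_iff less_top[symmetric])
qed auto

text \<open>Variance is invariant under the shift by \<open>m\<close>, and it is the second moment
  about \<open>m\<close> minus a square. Expanding \<open>(x - a)\<^sup>2\<close> around
  \<open>m\<close> reduces integrability for any centre to that for \<open>m\<close>; the centre
  used later is the mean.\<close>

lemma
  assumes "s > 0"
  shows fisher_information_le: "fisher_information R (- s) \<le> (\<integral>x. (x - m)\<^sup>2 \<partial>exp_family R (- s))" (is ?A)
    and integrable_exp_family_centred: "integrable (exp_family R (- s)) (\<lambda>x. (x - a)\<^sup>2)" (is ?B)
proof -
  interpret P: prob_space "exp_family R (- s)"
    using prob_space_exp_family assms by auto
  note i2 = integrable_exp_family_square[OF assms]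
  have i1: "integrable (exp_family R (- s)) (\<lambda>x. x - m)"
    using i2 by (rule P.square_integrable_imp_integrable[rotated]) simp
  have i0: "integrable (exp_family R (- s)) (\<lambda>x. x)"
    using Bochner_Integration.integrable_add[OF i1 P.integrable_const[of m]] by simp
  have mean: "exp_mean R (- s) - m = P.expectation (\<lambda>x. x - m)"
    using i0 P.prob_space by (simp add: exp_mean_def)
  have "fisher_information R (- s) = P.variance (\<lambda>x. x - m)"
    unfolding fisher_information_def mean[symmetric] by (simp add: algebra_simps)
  also have "\<dots> = P.expectation (\<lambda>x. (x - m)\<^sup>2) - (P.expectation (\<lambda>x. x - m))\<^sup>2"
    by (rule P.variance_eq[OF i1 i2])
  finally show ?A by simp
  have "(\<lambda>x. (x - a)\<^sup>2) = (\<lambda>x. (x - m)\<^sup>2 + 2 * (m - a) * (x - m) + (m - a)\<^sup>2)"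
    by (auto simp: power2_eq_square algebra_simps)
  then show ?B using i1 i2 by simp
qed

lemma ennreal_fisher_information_le:
  assumes "s > 0"
  shows "ennreal (fisher_information R (- s))
    \<le> (\<integral>\<^sup>+x. ennreal (exp (- s * (x - m)) * (x - m)\<^sup>2) \<partial>R) / Lap s"
proof -
  have "ennreal (fisher_information R (- s)) \<le> ennreal (\<integral>x. (x - m)\<^sup>2 \<partial>exp_family R (- s))"
    by (intro ennreal_leI fisher_information_le assms)
  also have "\<dots> = (\<integral>\<^sup>+x. ennreal ((x - m)\<^sup>2) \<partial>exp_family R (- s))"
    using integrable_exp_family_square[OF assms] by (intro nn_integral_eq_integral[symmetric]) auto
  finally show ?thesis
    by (simp add: nn_integral_exp_family ennreal_mult''[symmetric])
qed

lemma ennreal_fisher_information_eq: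
  assumes "s > 0"
  shows "ennreal (fisher_information R (- s))
    = (\<integral>\<^sup>+x. ennreal (exp (- s * (x - m)) * (x - exp_mean R (- s))\<^sup>2) \<partial>R) / Lap s"
proof -
  have "ennreal (fisher_information R (- s))
      = (\<integral>\<^sup>+x. ennreal ((x - exp_mean R (- s))\<^sup>2) \<partial>exp_family R (- s))"
    unfolding fisher_information_def
    using integrable_exp_family_centred[OF assms] by (intro nn_integral_eq_integral[symmetric]) auto
  then show ?thesis
    by (simp add: nn_integral_exp_family ennreal_mult''[symmetric])
qed

end

section \<open>Upper variance bound in the presence of a point mass\<close>

text \<open>The point mass keeps \<open>Lap s\<close> above a constant, and
  \<open>power2_mult_exp_le\<close> bounds the second moment about \<open>m\<close>. The negative
  moment can be finite despite the point mass because \<open>0 powr - p = 0\<close>: the integrand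
  vanishes at \<open>m\<close>.\<close>

lemma (in left_bounded_measure) fisher_information_upper_bound:
  assumes "emeasure R {m} > 0" "p > 0"
    and "(\<integral>\<^sup>+x. ennreal ((x - m) powr - p) \<partial>R) < \<infinity>"
  obtains D where "D \<ge> 0" "\<And>s. s > 0 \<Longrightarrow> fisher_information R (- s) \<le> D * s powr (- (2 + p))"
proof -
  obtain h where h: "h \<ge> 0" "(\<integral>\<^sup>+x. ennreal ((x - m) powr - p) \<partial>R) = ennreal h"
    using assms(3) by (cases "\<integral>\<^sup>+x. ennreal ((x - m) powr - p) \<partial>R") auto
  define a where "a = measure R {m}"
  have a: "emeasure R {m} = ennreal a" "a > 0"
    using assms(1) by (simp_all add: a_def emeasure_eq_measure)
  define K where "K = (2 + p) powr (2 + p)"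
  have "fisher_information R (- s) \<le> (K * h / a) * s powr (- (2 + p))" if s: "s > 0" for s
  proof -
    have "a \<le> Lap s"
    proof -
      have "ennreal a = (\<integral>\<^sup>+x. indicator {m} x \<partial>R)"
        using a by simp
      also have "\<dots> \<le> Lap s"
        unfolding Lap_def by (intro nn_integral_mono) (auto split: split_indicator)
      finally show ?thesis .
    qed
    have "(\<integral>\<^sup>+x. ennreal (exp (- s * (x - m)) * (x - m)\<^sup>2) \<partial>R)
        \<le> (\<integral>\<^sup>+x. ennreal (K * s powr (- (2 + p))) * ennreal ((x - m) powr - p) \<partial>R)"
    proof (rule nn_integral_mono_AE)
      show "AE x in R. ennreal (exp (- s * (x - m)) * (x - m)\<^sup>2)
          \<le> ennreal (K * s powr (- (2 + p))) * ennreal ((x - m) powr - p)"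
        using AE_ge
      proof eventually_elim
        case (elim x)
        then show ?case
          using power2_mult_exp_le[of s p "x - m"] s assms(2)
          by (simp add: K_def ennreal_mult''[symmetric] ennreal_leI)
      qed
    qed
    also have "\<dots> = ennreal (K * s powr (- (2 + p))) * ennreal h"
      unfolding h(2)[symmetric] by (intro nn_integral_cmult) measurable
    also have "\<dots> = ennreal a * ennreal ((K * h / a) * s powr (- (2 + p)))"
      using a h by (simp add: ennreal_mult'[symmetric] K_def mult.commute)
    also have "\<dots> \<le> Lap s * ennreal ((K * h / a) * s powr (- (2 + p)))"
      using \<open>a \<le> Lap s\<close> by (rule mult_right_mono) simp
    finally have "(\<integral>\<^sup>+x. ennreal (exp (- s * (x - m)) * (x - m)\<^sup>2) \<partial>R) / Lap s
        \<le> ennreal ((K * h / a) * s powr (- (2 + p)))"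
      by (intro divide_le_posI_ennreal Lap_pos)
    then have "ennreal (fisher_information R (- s)) \<le> ennreal ((K * h / a) * s powr (- (2 + p)))"
      using ennreal_fisher_information_le[OF s] by (rule order.trans[rotated])
    then show ?thesis
      using a h by (subst (asm) ennreal_le_iff) (auto simp: K_def)
  qed
  moreover have "K * h / a \<ge> 0"
    using a h by (simp add: K_def)
  ultimately show ?thesis by (rule that[rotated])
qed

section \<open>Measures with a power-like density at the left end\<close>

lemma nn_integral_shift_Ioo:
  fixes f :: "real \<Rightarrow> ennreal" and m d :: real
  assumes [measurable]: "f \<in> borel_measurable borel"
  shows "(\<integral>\<^sup>+x. f (x - m) * indicator {m<..<m + d} x \<partial>lborel)
    = (\<integral>\<^sup>+y. f y * indicator {0<..<d} y \<partial>lborel)"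
  by (subst nn_integral_real_affine[of _ 1 m]) (auto intro!: nn_integral_cong split: split_indicator)

text \<open>Two-sided comparison with \<open>(x - m) powr (\<gamma> - 1)\<close>, phrased through
  integrals of test functions so that the estimates can be applied directly. The open interval omits
  \<open>m\<close>, so the same assumptions cover measures with and without a point mass
  there.\<close>

locale power_like_left_end = left_bounded_measure +
  fixes \<gamma> \<delta> c C :: real
  assumes \<delta>_pos: "\<delta> > 0" and c_pos: "c > 0" and C_pos: "C > 0"
    and lower_density: "\<And>h. h \<in> borel_measurable borel \<Longrightarrow>
      (\<integral>\<^sup>+x. ennreal (c * (x - m) powr (\<gamma> - 1)) * h x * indicator {m<..<m + \<delta>} x \<partial>lborel)
        \<le> (\<integral>\<^sup>+x. h x * indicator {m<..<m + \<delta>} x \<partial>R)"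
    and upper_density: "\<And>h. h \<in> borel_measurable borel \<Longrightarrow>
      (\<integral>\<^sup>+x. h x * indicator {m<..<m + \<delta>} x \<partial>R)
        \<le> (\<integral>\<^sup>+x. ennreal (C * (x - m) powr (\<gamma> - 1)) * h x * indicator {m<..<m + \<delta>} x \<partial>lborel)"
begin

text \<open>For \<open>\<gamma> \<le> 0\<close> the density dominates a multiple of
  \<open>1 / y\<close> at distance \<open>y\<close> from \<open>m\<close>, which would give the
  finite measure \<open>R\<close> infinite mass.\<close>

lemma \<gamma>_pos: "\<gamma> > 0"
proof (rule ccontr)
  assume "\<not> \<gamma> > 0"
  have "\<infinity> = ennreal (c * \<delta> powr \<gamma>) * (\<integral>\<^sup>+y. ennreal (1 / y) * indicator {0<..<\<delta>} y \<partial>lborel)"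
    using \<delta>_pos c_pos by (simp add: nn_integral_inverse_at_0 ennreal_mult_top)
  also have "\<dots> = (\<integral>\<^sup>+y. ennreal (c * \<delta> powr \<gamma>) * (ennreal (1 / y) * indicator {0<..<\<delta>} y) \<partial>lborel)"
    by (intro nn_integral_cmult[symmetric]) measurable
  also have "\<dots> \<le> (\<integral>\<^sup>+y. ennreal (c * y powr (\<gamma> - 1)) * indicator {0<..<\<delta>} y \<partial>lborel)"
  proof (intro nn_integral_mono)
    fix y :: real
    have "c * \<delta> powr \<gamma> * (1 / y) \<le> c * y powr (\<gamma> - 1)" if "0 < y" "y < \<delta>"
      using that c_pos \<open>\<not> \<gamma> > 0\<close> by (simp add: powr_diff divide_right_mono powr_mono2')
    then show "ennreal (c * \<delta> powr \<gamma>) * (ennreal (1 / y) * indicator {0<..<\<delta>} y)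
        \<le> ennreal (c * y powr (\<gamma> - 1)) * indicator {0<..<\<delta>} y"
      using c_pos by (auto split: split_indicator simp: ennreal_mult'[symmetric] ennreal_leI)
  qed
  also have "\<dots> = (\<integral>\<^sup>+x. ennreal (c * (x - m) powr (\<gamma> - 1)) * 1 * indicator {m<..<m + \<delta>} x \<partial>lborel)"
    by (simp add: nn_integral_shift_Ioo[where f = "\<lambda>y. ennreal (c * y powr (\<gamma> - 1))"])
  also have "\<dots> \<le> (\<integral>\<^sup>+x. 1 * indicator {m<..<m + \<delta>} x \<partial>R)"
    by (intro lower_density) measurable
  also have "\<dots> < \<infinity>"
    by (rule nn_integral_less_top_of_bounded[of _ 1]) (auto split: split_indicator)
  finally show False by simp
qed

text \<open>Half of the exponent is given away: near \<open>m\<close> the integrand becomes a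
  multiple of \<open>y powr (\<gamma> / 2 - 1)\<close>, still integrable at 0. Farther out the
  negative power is bounded and \<open>R\<close> is finite.\<close>

lemma nn_integral_negative_power_less_top:
  "(\<integral>\<^sup>+x. ennreal ((x - m) powr - (\<gamma> / 2)) \<partial>R) < \<infinity>"
proof -
  let ?h = "\<lambda>x. ennreal ((x - m) powr - (\<gamma> / 2))"
  let ?I = "indicator {m<..<m + \<delta>} :: real \<Rightarrow> ennreal"
  have "(\<integral>\<^sup>+x. ?h x \<partial>R) \<le> (\<integral>\<^sup>+x. ?h x * ?I x + ennreal (\<delta> powr - (\<gamma> / 2)) \<partial>R)"
  proof (rule nn_integral_mono_AE)
    show "AE x in R. ?h x \<le> ?h x * ?I x + ennreal (\<delta> powr - (\<gamma> / 2))"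
      using AE_ge
    proof eventually_elim
      case (elim x)
      show ?case
      proof (cases "x < m + \<delta> \<and> x \<noteq> m")
        \<comment> \<open>This case includes \<open>x = m\<close>, where the negative power takes
          the default value 0.\<close>
        case False
        then have "(x - m) powr - (\<gamma> / 2) \<le> \<delta> powr - (\<gamma> / 2)"
          using elim \<delta>_pos \<gamma>_pos by (cases "x = m") (auto intro!: powr_mono2')
        then show ?thesis
          by (auto intro: ennreal_leI add_increasing)
      qed (use elim in auto)
    qed
  qed
  also have "\<dots> = (\<integral>\<^sup>+x. ?h x * ?I x \<partial>R) + (\<integral>\<^sup>+x. ennreal (\<delta> powr - (\<gamma> / 2)) \<partial>R)"
    by (intro nn_integral_add) auto
  also have "\<dots> < \<infinity>"
  proof -
    have "(\<integral>\<^sup>+x. ?h x * ?I x \<partial>R)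
        \<le> (\<integral>\<^sup>+x. ennreal (C * (x - m) powr (\<gamma> - 1)) * ?h x * ?I x \<partial>lborel)"
      by (intro upper_density) measurable
    also have "\<dots> = (\<integral>\<^sup>+y. ennreal (C * y powr (\<gamma> - 1)) * ennreal (y powr - (\<gamma> / 2)) * indicator {0<..<\<delta>} y \<partial>lborel)"
      by (rule nn_integral_shift_Ioo[where f = "\<lambda>y. ennreal (C * y powr (\<gamma> - 1)) * ennreal (y powr - (\<gamma> / 2))"])
        measurable
    also have "\<dots> = (\<integral>\<^sup>+y. ennreal C * (ennreal (y powr (\<gamma> / 2 - 1)) * indicator {0<..<\<delta>} y) \<partial>lborel)"
      using C_pos
      by (intro nn_integral_cong)
        (auto split: split_indicator simp: ennreal_mult'[symmetric] mult.assoc powr_add[symmetric] algebra_simps)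
    also have "\<dots> = ennreal C * (\<integral>\<^sup>+y. ennreal (y powr (\<gamma> / 2 - 1)) * indicator {0<..<\<delta>} y \<partial>lborel)"
      by (intro nn_integral_cmult) measurable
    also have "\<dots> < \<infinity>"
      using nn_integral_powr_at_0[of "\<gamma> / 2" \<delta>] \<gamma>_pos \<delta>_pos by (simp add: ennreal_mult_less_top)
    finally have "(\<integral>\<^sup>+x. ?h x * ?I x \<partial>R) < \<infinity>" .
    moreover have "(\<integral>\<^sup>+x. ennreal (\<delta> powr - (\<gamma> / 2)) \<partial>R) < \<infinity>"
      by (rule nn_integral_less_top_of_bounded) auto
    ultimately show ?thesis by simp
  qed
  finally show ?thesis .
qed

text \<open>Near \<open>m\<close> the density bound leads to a Gamma integral of order
  \<open>s powr - \<gamma>\<close>. Beyond \<open>m + \<delta>\<close> the exponential is itself at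
  most a constant times \<open>s powr - \<gamma>\<close>. The remaining point \<open>m\<close> is
  null by assumption.\<close>

lemma Lap_upper_bound:
  assumes "emeasure R {m} = 0"
  obtains B where "B > 0" "\<And>s. s > 0 \<Longrightarrow> Lap s \<le> ennreal (B * s powr - \<gamma>)"
proof -
  define r where "r = measure R (space R)"
  define B where "B = C * Gamma \<gamma> + \<gamma> powr \<gamma> * \<delta> powr - \<gamma> * r"
  let ?I = "indicator {m<..<m + \<delta>} :: real \<Rightarrow> ennreal"
  have "AE x in R. x \<noteq> m"
    using assms by (subst AE_iff_measurable[of "{m}"]) auto
  with AE_ge have AE_gt: "AE x in R. m < x"
    by eventually_elim auto
  have "Lap s \<le> ennreal (B * s powr - \<gamma>)" if s: "s > 0" for s
  proof -
    let ?e = "\<lambda>x. ennreal (exp (- s * (x - m)))"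
    \<comment> \<open>Bounds the exponential weight at all points whose distance from
      \<open>m\<close> is at least \<open>\<delta>\<close>.\<close>
    define k where "k = \<gamma> powr \<gamma> * s powr - \<gamma> * \<delta> powr - \<gamma>"
    have k: "k \<ge> 0" by (simp add: k_def)
    have "Lap s \<le> (\<integral>\<^sup>+x. ?e x * ?I x + ennreal k \<partial>R)"
      unfolding Lap_def
    proof (rule nn_integral_mono_AE)
      show "AE x in R. ?e x \<le> ?e x * ?I x + ennreal k"
        using AE_gt
      proof eventually_elim
        case (elim x)
        show ?case
        proof (cases "x < m + \<delta>")
          case False
          then have "\<delta> powr \<gamma> * exp (- s * (x - m)) \<le> (x - m) powr \<gamma> * exp (- s * (x - m))"
            using \<delta>_pos \<gamma>_pos by (intro mult_right_mono powr_mono2) auto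
          also have "\<dots> \<le> \<gamma> powr \<gamma> * s powr - \<gamma>"
            using elim s \<gamma>_pos by (intro powr_mult_exp_scaled_le) auto
          finally have "exp (- s * (x - m)) \<le> \<gamma> powr \<gamma> * s powr - \<gamma> / \<delta> powr \<gamma>"
            using \<delta>_pos by (simp add: pos_le_divide_eq mult.commute)
          then have "exp (- s * (x - m)) \<le> k"
            by (simp only: k_def powr_minus divide_inverse)
          then show ?thesis
            by (auto intro: ennreal_leI add_increasing)
        qed (use elim in auto)
      qed
    qed
    also have "\<dots> = (\<integral>\<^sup>+x. ?e x * ?I x \<partial>R) + (\<integral>\<^sup>+x. ennreal k \<partial>R)"
      by (intro nn_integral_add) auto
    also have "(\<integral>\<^sup>+x. ennreal k \<partial>R) = ennreal (k * r)"
      by (simp add: r_def emeasure_eq_measure ennreal_mult' k)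
    also have "(\<integral>\<^sup>+x. ?e x * ?I x \<partial>R) \<le> ennreal (C * Gamma \<gamma> * s powr - \<gamma>)"
    proof -
      have "(\<integral>\<^sup>+x. ?e x * ?I x \<partial>R)
          \<le> (\<integral>\<^sup>+x. ennreal (C * (x - m) powr (\<gamma> - 1)) * ?e x * ?I x \<partial>lborel)"
        by (intro upper_density) measurable
      also have "\<dots> = (\<integral>\<^sup>+y. ennreal (C * y powr (\<gamma> - 1)) * ennreal (exp (- s * y)) * indicator {0<..<\<delta>} y \<partial>lborel)"
        by (rule nn_integral_shift_Ioo[where f = "\<lambda>y. ennreal (C * y powr (\<gamma> - 1)) * ennreal (exp (- s * y))"])
          measurable
      also have "\<dots> \<le> (\<integral>\<^sup>+y. ennreal C * (ennreal (y powr (\<gamma> - 1) * exp (- s * y)) * indicator {0<..} y) \<partial>lborel)"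
        using C_pos
        by (intro nn_integral_mono) (auto split: split_indicator simp: ennreal_mult'[symmetric] mult.assoc)
      also have "\<dots> = ennreal C * (\<integral>\<^sup>+y. ennreal (y powr (\<gamma> - 1) * exp (- s * y)) * indicator {0<..} y \<partial>lborel)"
        by (intro nn_integral_cmult) measurable
      also have "\<dots> \<le> ennreal C * ennreal (Gamma \<gamma> * s powr - \<gamma>)"
        by (intro mult_left_mono nn_integral_powr_exp_scaled \<gamma>_pos s) simp
      finally show ?thesis
        using C_pos by (simp add: ennreal_mult'[symmetric] mult.assoc)
    qed
    also have "ennreal (C * Gamma \<gamma> * s powr - \<gamma>) + ennreal (k * r) = ennreal (B * s powr - \<gamma>)"
      using C_pos \<gamma>_pos k
      by (simp add: B_def k_def r_def Gamma_real_pos less_imp_le ennreal_plus[symmetric] algebra_simps del: ennreal_plus)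
    finally show ?thesis by simp
  qed
  moreover have "B > 0"
    unfolding B_def r_def using C_pos \<gamma>_pos by (intro add_pos_nonneg) (auto simp: Gamma_real_pos)
  ultimately show ?thesis by (rule that[rotated])
qed

text \<open>Of the two intervals at distances about \<open>1 / (2 * s)\<close> and \<open>2 / s\<close> from \<open>m\<close>, at least one is at
  distance at least \<open>1 / (2 * s)\<close> from any given centre \<open>a\<close>.\<close>

lemma second_moment_lower_bound:
  obtains k where "k > 0" "\<And>s a. s > 3 / \<delta> \<Longrightarrow>
    ennreal (k * s powr (- \<gamma> - 2)) \<le> (\<integral>\<^sup>+x. ennreal (exp (- s * (x - m)) * (x - a)\<^sup>2) \<partial>R)"
proof -
  \<comment> \<open>Lower bound for \<open>u powr (\<gamma> - 1)\<close> on the rescaled range; the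
    absolute value treats both signs of \<open>\<gamma> - 1\<close> at once.\<close>
  define \<kappa> where "\<kappa> = exp (- \<bar>\<gamma> - 1\<bar> * ln 3)"
  have \<kappa>: "\<kappa> \<le> u powr (\<gamma> - 1)" if "1 / 2 \<le> u" "u \<le> 3" for u :: real
  proof -
    have "ln (1 / 3) \<le> ln u" "ln u \<le> ln 3"
      using that by (subst ln_le_cancel_iff; simp)+
    then have "\<bar>ln u\<bar> \<le> ln 3"
      by (simp add: ln_div)
    then have "\<bar>(\<gamma> - 1) * ln u\<bar> \<le> \<bar>\<gamma> - 1\<bar> * ln 3"
      by (simp add: abs_mult mult_left_mono)
    then show ?thesis
      using that by (simp add: \<kappa>_def powr_def)
  qed
  define k where "k = c * \<kappa> * exp (- 3) / 8"
  have "ennreal (k * s powr (- \<gamma> - 2)) \<le> (\<integral>\<^sup>+x. ennreal (exp (- s * (x - m)) * (x - a)\<^sup>2) \<partial>R)"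
    if s\<delta>: "s > 3 / \<delta>" for s a
  proof -
    have s: "s > 0" using s\<delta> \<delta>_pos by (meson divide_pos_pos less_trans zero_less_numeral)
    have s3: "3 / s < \<delta>" using s\<delta> s \<delta>_pos by (simp add: field_simps)
    \<comment> \<open>In the variable \<open>u = s * (x - m)\<close> the candidate intervals are
      \<open>(1 / 2, 1)\<close> and \<open>(2, 5 / 2)\<close>. The threshold \<open>3 / 2\<close> is
      midway between 1 and 2, so the chosen interval stays \<open>1 / 2\<close> away from the
      rescaled centre.\<close>
    define l where "l = (if a \<le> m + 3 / (2 * s) then 2 else 1 / 2 :: real)"
    define J where "J = {m + l / s <..< m + (l + 1 / 2) / s}"
    \<comment> \<open>A lower bound on \<open>J\<close> for density times integrand:
      \<open>\<kappa> * s powr (1 - \<gamma>)\<close> for the power, \<open>exp (- 3)\<close>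
      because \<open>u \<le> 3\<close>, and the squared distance to \<open>a\<close>. Multiplying by
      the length \<open>1 / (2 * s)\<close> of \<open>J\<close> gives the factor 8 in
      \<open>k\<close>.\<close>
    define v where "v = c * (\<kappa> * s powr (1 - \<gamma>)) * (exp (- 3) * (1 / (2 * s))\<^sup>2)"
    let ?h = "\<lambda>x. ennreal (exp (- s * (x - m)) * (x - a)\<^sup>2)"
    let ?I = "indicator {m<..<m + \<delta>} :: real \<Rightarrow> ennreal"
    have J: "m < x \<and> x < m + \<delta> \<and> v \<le> c * (x - m) powr (\<gamma> - 1) * (exp (- s * (x - m)) * (x - a)\<^sup>2)"
      if "x \<in> J" for x
    proof -
      define u where "u = s * (x - m)"
      have xu: "x = m + u / s" using s by (simp add: u_def)
      have u: "l < u" "u < l + 1 / 2"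
        using that s by (simp_all add: J_def u_def field_simps)
      have l: "1 / 2 \<le> l" "l \<le> 2" by (auto simp: l_def)
      have "u / s \<le> 3 / s" using s u l by (intro divide_right_mono) auto
      with s3 have 1: "m < x" "x < m + \<delta>"
        using s u l by (auto simp: xu)
      have 2: "\<kappa> * s powr (1 - \<gamma>) \<le> (x - m) powr (\<gamma> - 1)"
      proof -
        have "\<kappa> * s powr (1 - \<gamma>) \<le> u powr (\<gamma> - 1) * s powr (1 - \<gamma>)"
          using u l by (intro mult_right_mono \<kappa>) auto
        also have "\<dots> = u powr (\<gamma> - 1) * (1 / s powr (\<gamma> - 1))"
          using powr_minus_divide[of s "\<gamma> - 1"] by simp
        also have "\<dots> = (x - m) powr (\<gamma> - 1)"
          using u l s by (simp add: xu powr_divide)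
        finally show ?thesis .
      qed
      have 3: "exp (- 3) \<le> exp (- s * (x - m))"
        using u l by (simp add: u_def)
      have "1 / (2 * s) \<le> \<bar>x - a\<bar>"
      proof (cases "a \<le> m + 3 / (2 * s)")
        case True
        then have "2 / s \<le> u / s" using u s by (intro divide_right_mono) (auto simp: l_def)
        moreover have "2 / s = 3 / (2 * s) + 1 / (2 * s)" using s by (simp add: field_simps)
        ultimately have "1 / (2 * s) \<le> x - a" using True by (simp only: xu)
        then show ?thesis by linarith
      next
        case False
        then have "u / s \<le> 1 / s" using u s by (intro divide_right_mono) (auto simp: l_def)
        moreover have "1 / s = 3 / (2 * s) - 1 / (2 * s)" using s by (simp add: field_simps)
        ultimately have "1 / (2 * s) \<le> a - x" using False by (simp only: xu)
        then show ?thesis by linarith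
      qed
      then have 4: "(1 / (2 * s))\<^sup>2 \<le> (x - a)\<^sup>2"
        using s by (subst power2_abs[symmetric, of "x - a"]) (intro power_mono; simp)
      have "v \<le> c * (x - m) powr (\<gamma> - 1) * (exp (- s * (x - m)) * (x - a)\<^sup>2)"
        unfolding v_def using 2 3 4 c_pos by (intro mult_mono) (auto simp: \<kappa>_def)
      with 1 show ?thesis by simp
    qed
    have "v * (1 / (2 * s)) = k * s powr (- \<gamma> - 2)"
    proof -
      have "s powr (1 - \<gamma>) = s powr (- \<gamma> - 2) * s ^ 3"
        using s powr_add[of s "- \<gamma> - 2" 3] by simp
      then show ?thesis
        using s by (simp add: v_def k_def power2_eq_square power3_eq_cube)
    qed
    then have "ennreal (k * s powr (- \<gamma> - 2)) = ennreal v * ennreal (1 / (2 * s))"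
      using s by (simp add: ennreal_mult''[symmetric])
    also have "ennreal (1 / (2 * s)) = emeasure lborel J"
    proof -
      have "(l + 1 / 2) / s - l / s = 1 / (2 * s)" using s by (simp add: field_simps)
      then show ?thesis using s by (simp add: J_def divide_right_mono)
    qed
    also have "ennreal v * emeasure lborel J = (\<integral>\<^sup>+x. ennreal v * indicator J x \<partial>lborel)"
      by (simp add: nn_integral_cmult_indicator J_def)
    also have "\<dots> \<le> (\<integral>\<^sup>+x. ennreal (c * (x - m) powr (\<gamma> - 1)) * ?h x * ?I x \<partial>lborel)"
    proof (rule nn_integral_mono)
      fix x
      show "ennreal v * indicator J x \<le> ennreal (c * (x - m) powr (\<gamma> - 1)) * ?h x * ?I x"
        using J[of x] c_pos by (auto split: split_indicator simp: ennreal_mult'[symmetric] ennreal_leI)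
    qed
    also have "\<dots> \<le> (\<integral>\<^sup>+x. ?h x * ?I x \<partial>R)"
      by (intro lower_density) measurable
    also have "\<dots> \<le> (\<integral>\<^sup>+x. ?h x \<partial>R)"
      by (intro nn_integral_mono) (auto split: split_indicator)
    finally show ?thesis .
  qed
  moreover have "k > 0"
    using c_pos by (simp add: k_def \<kappa>_def)
  ultimately show ?thesis by (rule that[rotated])
qed

text \<open>The second moment about the mean has order at least
  \<open>s powr (- \<gamma> - 2)\<close> and the normalising constant order at most
  \<open>s powr - \<gamma>\<close>, so \<open>\<gamma>\<close> cancels from the quotient.\<close>

lemma fisher_information_lower_bound:
  assumes "emeasure R {m} = 0"
  obtains d where "d > 0" "\<And>s. s > 3 / \<delta> \<Longrightarrow> d / s\<^sup>2 \<le> fisher_information R (- s)"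
proof -
  obtain B where B: "B > 0" "\<And>s. s > 0 \<Longrightarrow> Lap s \<le> ennreal (B * s powr - \<gamma>)"
    by (rule Lap_upper_bound[OF assms]) (rule that)
  obtain k where k: "k > 0" "\<And>s a. s > 3 / \<delta> \<Longrightarrow>
      ennreal (k * s powr (- \<gamma> - 2)) \<le> (\<integral>\<^sup>+x. ennreal (exp (- s * (x - m)) * (x - a)\<^sup>2) \<partial>R)"
    by (rule second_moment_lower_bound) (rule that)
  have "k / B / s\<^sup>2 \<le> fisher_information R (- s)" if s\<delta>: "s > 3 / \<delta>" for s
  proof -
    have s: "s > 0" using s\<delta> \<delta>_pos by (meson divide_pos_pos less_trans zero_less_numeral)
    have "ennreal (k / B / s\<^sup>2) = ennreal (k / B / s\<^sup>2) * Lap s / Lap s"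
      using Lap_pos[of s] Lap_less_top[of s] s by (subst mult_divide_eq_ennreal) auto
    also have "\<dots> \<le> ennreal (k / B / s\<^sup>2) * ennreal (B * s powr - \<gamma>) / Lap s"
      by (intro divide_right_mono_ennreal mult_left_mono B s) simp
    also have "ennreal (k / B / s\<^sup>2) * ennreal (B * s powr - \<gamma>) = ennreal (k * s powr (- \<gamma> - 2))"
      using s B k by (simp add: ennreal_mult''[symmetric] powr_diff)
    also have "ennreal (k * s powr (- \<gamma> - 2)) / Lap s
        \<le> (\<integral>\<^sup>+x. ennreal (exp (- s * (x - m)) * (x - exp_mean R (- s))\<^sup>2) \<partial>R) / Lap s"
      by (intro divide_right_mono_ennreal k s\<delta>)
    also have "\<dots> = ennreal (fisher_information R (- s))"
      by (rule ennreal_fisher_information_eq[OF s, symmetric])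
    finally show ?thesis
      by (subst (asm) ennreal_le_iff) (auto simp: fisher_information_def)
  qed
  moreover have "k / B > 0" using k B by simp
  ultimately show ?thesis by (rule that[rotated])
qed

end

section \<open>From \<open>Q\<close> to its exponential tilts\<close>

text \<open>Every point below \<open>m\<close> has an open null neighbourhood. By the Lindelof
  property countably many of these have the same union, which is therefore null.\<close>

lemma AE_ge_Inf_measure_support:
  assumes sets: "sets Q = sets borel" and Inf: "Inf (ereal ` measure_support Q) = ereal m"
  shows "AE x in Q. m \<le> x"
proof -
  define \<F> where "\<F> = {U. open U \<and> emeasure Q U = 0}"
  have cover: "x \<in> \<Union>\<F>" if "x < m" for x
  proof -
    have "x \<notin> measure_support Q"
    proof
      assume "x \<in> measure_support Q"
      then have "ereal m \<le> ereal x"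
        unfolding Inf[symmetric] by (intro Inf_lower) auto
      with that show False by simp
    qed
    then show ?thesis
      by (auto simp: measure_support_def \<F>_def zero_less_iff_neq_zero)
  qed
  obtain \<F>' where \<F>': "\<F>' \<subseteq> \<F>" "countable \<F>'" "\<Union>\<F>' = \<Union>\<F>"
    using Lindelof[of \<F>] by (auto simp: \<F>_def)
  have "(\<Union>U\<in>\<F>'. U) \<in> null_sets Q"
    using \<F>' sets by (intro null_sets_UN') (auto simp: \<F>_def null_sets_def)
  then show ?thesis
    by (rule AE_I') (use cover \<F>' in \<open>auto simp: not_le\<close>)
qed

lemma partition_fun_density_exp:
  assumes [measurable_cong]: "sets Q = sets borel"
  shows "partition_fun (density Q (\<lambda>x. ennreal (exp (b * x)))) a = partition_fun Q (b + a)"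
  unfolding partition_fun_def
  by (subst nn_integral_density) (auto simp: ennreal_mult''[symmetric] exp_add[symmetric] algebra_simps)

lemma exp_family_density_exp:
  assumes [measurable_cong]: "sets Q = sets borel"
  shows "exp_family (density Q (\<lambda>x. ennreal (exp (b * x)))) a = exp_family Q (b + a)"
proof -
  have "ennreal (exp (b * x)) * (ennreal (exp (a * x)) / z) = ennreal (exp ((b + a) * x)) / z" for x z
    by (simp add: ennreal_times_divide ennreal_mult''[symmetric] exp_add[symmetric] algebra_simps)
  then show ?thesis
    unfolding exp_family_def partition_fun_density_exp[OF assms]
    by (subst density_density_eq) auto
qed

text \<open>Tilting by \<open>b\<close> merely shifts the canonical parameter, so variances in the
  family of \<open>Q\<close> can be computed from a finite tilt.\<close>

lemma fisher_information_density_exp: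
  assumes "sets Q = sets borel"
  shows "fisher_information (density Q (\<lambda>x. ennreal (exp (b * x)))) a = fisher_information Q (b + a)"
  by (simp add: fisher_information_def exp_mean_def exp_family_density_exp[OF assms])

text \<open>On \<open>x \<ge> m\<close> the ratio \<open>exp ((a - b) * x)\<close> of the two
  weights is largest at \<open>m\<close>.\<close>

lemma can_params_downward_closed:
  assumes [measurable_cong]: "sets Q = sets borel" and AE: "AE x in Q. m \<le> x"
    and "b \<in> can_params Q" "a \<le> b"
  shows "a \<in> can_params Q"
proof -
  have "partition_fun Q a \<le> (\<integral>\<^sup>+x. ennreal (exp ((a - b) * m)) * ennreal (exp (b * x)) \<partial>Q)"
    unfolding partition_fun_def
  proof (rule nn_integral_mono_AE)
    show "AE x in Q. ennreal (exp (a * x)) \<le> ennreal (exp ((a - b) * m)) * ennreal (exp (b * x))"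
      using AE
    proof eventually_elim
      case (elim x)
      then have "(a - b) * x \<le> (a - b) * m"
        using assms(4) by (intro mult_left_mono_neg) auto
      then have "exp (a * x) \<le> exp ((a - b) * m) * exp (b * x)"
        by (simp add: exp_add[symmetric] algebra_simps)
      then show ?case by (simp add: ennreal_mult''[symmetric] ennreal_leI)
    qed
  qed
  also have "\<dots> = ennreal (exp ((a - b) * m)) * partition_fun Q b"
    unfolding partition_fun_def by (intro nn_integral_cmult) measurable
  also have "\<dots> < \<infinity>"
    using assms(3) by (simp add: can_params_def ennreal_mult_less_top)
  finally show ?thesis by (simp add: can_params_def)
qed

lemma left_bounded_measure_density_exp:
  assumes sets [measurable_cong]: "sets Q = sets borel" and AE: "AE x in Q. m \<le> x"
    and "emeasure Q (space Q) \<noteq> 0" and b: "b \<in> can_params Q"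
  shows "left_bounded_measure (density Q (\<lambda>x. ennreal (exp (b * x)))) m"
proof -
  let ?R = "density Q (\<lambda>x. ennreal (exp (b * x)))"
  have R: "emeasure ?R (space ?R) = partition_fun Q b"
    by (subst emeasure_density) (auto simp: partition_fun_def intro!: nn_integral_cong)
  have "\<not> (AE x in Q. ennreal (exp (b * x)) = 0)"
  proof
    assume "AE x in Q. ennreal (exp (b * x)) = 0"
    then have "AE x in Q. False"
      by eventually_elim (simp add: ennreal_eq_0_iff not_le)
    then show False
      using assms(3) ae_filter_eq_bot_iff[of Q] by (simp add: trivial_limit_def)
  qed
  then have "partition_fun Q b \<noteq> 0"
    unfolding partition_fun_def by (subst nn_integral_0_iff_AE) auto
  with R have nonzero: "emeasure ?R (space ?R) \<noteq> 0" by simp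
  have "finite_measure ?R"
    using R b by (intro finite_measureI) (simp add: can_params_def)
  then show ?thesis
  proof (intro left_bounded_measure.intro left_bounded_measure_axioms.intro)
    show "AE x in ?R. m \<le> x"
      using AE by (subst AE_density) auto
    show "sets ?R = sets borel"
      using sets by simp
  qed (use nonzero in blast)+
qed

text \<open>The density is given only for the measures restricted to \<open>A\<close>; the
  indicators carry the identity over to integrals on the whole line.\<close>

lemma nn_integral_has_lebesgue_density_on:
  assumes [measurable_cong]: "sets Q = sets borel" and f: "has_lebesgue_density_on Q f A"
    and [measurable]: "A \<in> sets borel" "h \<in> borel_measurable borel"
  shows "(\<integral>\<^sup>+x. h x * indicator A x \<partial>Q) = (\<integral>\<^sup>+x. ennreal (f x) * h x * indicator A x \<partial>lborel)"
proof -
  have [measurable]: "f \<in> borel_measurable (restrict_space lborel A)"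
    and eq: "restrict_space Q A = density (restrict_space lborel A) (\<lambda>x. ennreal (f x))"
    using f by (auto simp: has_lebesgue_density_on_def)
  have [measurable]: "h \<in> borel_measurable (restrict_space lborel A)"
    by (intro measurable_restrict_space1) measurable
  have "(\<integral>\<^sup>+x. h x * indicator A x \<partial>Q) = (\<integral>\<^sup>+x. h x \<partial>restrict_space Q A)"
    by (intro nn_integral_restrict_space[symmetric])
      (simp add: assms(1,3) sets_eq_imp_space_eq[OF assms(1)])
  also have "\<dots> = (\<integral>\<^sup>+x. ennreal (f x) * h x \<partial>restrict_space lborel A)"
    unfolding eq by (intro nn_integral_density) measurable
  also have "\<dots> = (\<integral>\<^sup>+x. ennreal (f x) * h x * indicator A x \<partial>lborel)"
    by (intro nn_integral_restrict_space) auto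
  finally show ?thesis .
qed

text \<open>Close to \<open>m\<close>, continuity keeps \<open>g\<close> between
  \<open>g m / 2\<close> and \<open>3 / 2 * g m\<close>, and the tilting weight lies between
  positive constants on a bounded interval. Only the power remains unbounded or degenerate
  there.\<close>

lemma power_like_left_end_density_exp:
  assumes sets [measurable_cong]: "sets Q = sets borel" and AE: "AE x in Q. m \<le> x"
    and nz: "emeasure Q (space Q) \<noteq> 0" and b: "b \<in> can_params Q" and "\<epsilon> > 0"
    and dens: "has_lebesgue_density_on Q (\<lambda>x. (x - m) powr (\<gamma> - 1) * g x) {m<..<m + \<epsilon>}"
    and cont: "isCont g m" and "g m > 0"
  obtains \<delta> c C where "power_like_left_end (density Q (\<lambda>x. ennreal (exp (b * x)))) m \<gamma> \<delta> c C"
proof -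
  obtain d where d: "d > 0" "\<And>x. \<bar>x - m\<bar> < d \<Longrightarrow> \<bar>g x - g m\<bar> < g m / 2"
    using cont \<open>g m > 0\<close> unfolding continuous_at_eps_delta dist_real_def by (meson half_gt_zero)
  \<comment> \<open>Short enough both for the bounds on \<open>g\<close> and for the density
    representation of \<open>Q\<close>.\<close>
  define \<delta> where "\<delta> = min d \<epsilon>"
  \<comment> \<open>Bounds the absolute value of \<open>b * x\<close> on the interval, for either
    sign of \<open>b\<close> and \<open>m\<close>.\<close>
  define E where "E = \<bar>b\<bar> * (\<bar>m\<bar> + \<delta>)"
  define c where "c = g m / 2 * exp (- E)"
  define C where "C = 3 / 2 * g m * exp E"
  let ?f = "\<lambda>x. (x - m) powr (\<gamma> - 1) * g x"
  let ?R = "density Q (\<lambda>x. ennreal (exp (b * x)))"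
  let ?I = "indicator {m<..<m + \<delta>} :: real \<Rightarrow> ennreal"
  have \<delta>: "\<delta> > 0" "\<delta> \<le> \<epsilon>" using d \<open>\<epsilon> > 0\<close> by (auto simp: \<delta>_def)
  have bounds: "c * (x - m) powr (\<gamma> - 1) \<le> ?f x * exp (b * x) \<and>
      ?f x * exp (b * x) \<le> C * (x - m) powr (\<gamma> - 1) \<and> 0 \<le> ?f x"
    if "m < x" "x < m + \<delta>" for x
  proof -
    have "\<bar>g x - g m\<bar> < g m / 2" using that by (intro d) (auto simp: \<delta>_def)
    then have g: "g m / 2 \<le> g x" "g x \<le> 3 / 2 * g m" by linarith+
    have "\<bar>b * x\<bar> \<le> E"
      unfolding E_def abs_mult using that by (intro mult_left_mono) auto
    then have e: "exp (- E) \<le> exp (b * x)" "exp (b * x) \<le> exp E" by auto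
    have "c \<le> g x * exp (b * x)" "g x * exp (b * x) \<le> C"
      unfolding c_def C_def using g e \<open>g m > 0\<close> by (intro mult_mono; simp)+
    from mult_right_mono[OF this(1), of "(x - m) powr (\<gamma> - 1)"]
      mult_right_mono[OF this(2), of "(x - m) powr (\<gamma> - 1)"] g \<open>g m > 0\<close>
    show ?thesis by (simp add: ac_simps)
  qed
  have integral: "(\<integral>\<^sup>+x. h x * ?I x \<partial>?R)
      = (\<integral>\<^sup>+x. ennreal (?f x) * (ennreal (exp (b * x)) * h x * ?I x) * indicator {m<..<m + \<epsilon>} x \<partial>lborel)"
    if [measurable]: "h \<in> borel_measurable borel" for h
  proof -
    have "(\<integral>\<^sup>+x. h x * ?I x \<partial>?R) = (\<integral>\<^sup>+x. ennreal (exp (b * x)) * (h x * ?I x) \<partial>Q)"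
      by (intro nn_integral_density) measurable
    also have "\<dots> = (\<integral>\<^sup>+x. (ennreal (exp (b * x)) * h x * ?I x) * indicator {m<..<m + \<epsilon>} x \<partial>Q)"
      using \<delta> by (intro nn_integral_cong) (auto split: split_indicator simp: mult.assoc)
    also have "\<dots> = (\<integral>\<^sup>+x. ennreal (?f x) * (ennreal (exp (b * x)) * h x * ?I x) * indicator {m<..<m + \<epsilon>} x \<partial>lborel)"
      by (intro nn_integral_has_lebesgue_density_on[OF sets dens]) measurable
    finally show ?thesis .
  qed
  interpret left_bounded_measure ?R m
    by (rule left_bounded_measure_density_exp[OF sets AE nz b])
  have "power_like_left_end ?R m \<gamma> \<delta> c C"
  proof
    show "\<delta> > 0" "c > 0" "C > 0" using \<delta> \<open>g m > 0\<close> by (auto simp: c_def C_def)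
    fix h :: "real \<Rightarrow> ennreal" assume h: "h \<in> borel_measurable borel"
    show "(\<integral>\<^sup>+x. ennreal (c * (x - m) powr (\<gamma> - 1)) * h x * ?I x \<partial>lborel) \<le> (\<integral>\<^sup>+x. h x * ?I x \<partial>?R)"
      unfolding integral[OF h]
    proof (rule nn_integral_mono)
      fix x
      have "ennreal (c * (x - m) powr (\<gamma> - 1)) * h x \<le> ennreal (?f x) * ennreal (exp (b * x)) * h x"
        if "m < x" "x < m + \<delta>"
        using bounds[OF that] by (intro mult_right_mono) (auto simp: ennreal_mult''[symmetric] ennreal_leI)
      then show "ennreal (c * (x - m) powr (\<gamma> - 1)) * h x * ?I x
          \<le> ennreal (?f x) * (ennreal (exp (b * x)) * h x * ?I x) * indicator {m<..<m + \<epsilon>} x"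
        using \<delta> by (auto split: split_indicator simp: mult.assoc)
    qed
    show "(\<integral>\<^sup>+x. h x * ?I x \<partial>?R) \<le> (\<integral>\<^sup>+x. ennreal (C * (x - m) powr (\<gamma> - 1)) * h x * ?I x \<partial>lborel)"
      unfolding integral[OF h]
    proof (rule nn_integral_mono)
      fix x
      have "ennreal (?f x) * ennreal (exp (b * x)) * h x \<le> ennreal (C * (x - m) powr (\<gamma> - 1)) * h x"
        if "m < x" "x < m + \<delta>"
        using bounds[OF that] by (intro mult_right_mono) (auto simp: ennreal_mult''[symmetric] ennreal_leI)
      then show "ennreal (?f x) * (ennreal (exp (b * x)) * h x * ?I x) * indicator {m<..<m + \<epsilon>} x
          \<le> ennreal (C * (x - m) powr (\<gamma> - 1)) * h x * ?I x"
        using \<delta> by (auto split: split_indicator simp: mult.assoc)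
    qed
  qed
  then show ?thesis by (rule that)
qed

lemma real_analytic_on_imp_isCont:
  assumes "real_analytic_on g S" "x \<in> S"
  shows "isCont g x"
proof -
  obtain F where "(\<lambda>h. g (x + h)) has_fps_expansion F"
    using assms by (auto simp: real_analytic_on_def)
  then have "isCont (\<lambda>h. g (x + h)) 0"
    by (rule has_fps_expansion_imp_continuous)
  then show ?thesis
    unfolding isCont_iff[of x g] by (simp add: isCont_def)
qed

section \<open>Integration over the parameter and the equivalence\<close>

text \<open>The substitution \<open>s = b - \<beta>\<close> turns parameters going to minus infinity
  into Laplace parameters going to infinity.\<close>

lemma nn_integral_reflect_lessThan:
  fixes f :: "real \<Rightarrow> ennreal" and a b :: real
  assumes [measurable]: "f \<in> borel_measurable borel"
  shows "(\<integral>\<^sup>+\<beta>. f (b - \<beta>) * indicator {..<a} \<beta> \<partial>lborel) = (\<integral>\<^sup>+s. f s * indicator {b - a<..} s \<partial>lborel)"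
  by (subst nn_integral_real_affine[of _ "- 1" b]) (auto intro!: nn_integral_cong split: split_indicator)

theorem theorem4:
  fixes Q :: "real measure" and g :: "real \<Rightarrow> real" and m \<epsilon> \<gamma> :: real
  assumes "sets Q = sets borel" and "sigma_finite_measure Q" and "emeasure Q (space Q) \<noteq> 0"
    and "can_params Q \<noteq> {}"
    and "mu_inf Q = ereal m"
    and "Inf (ereal ` measure_support Q) = ereal m"
    and "\<epsilon> > 0"
    and "has_lebesgue_density_on Q (\<lambda>x. (x - m) powr (\<gamma> - 1) * g x) {m<..<m + \<epsilon>}"
    and "real_analytic_on g {m..<m + \<epsilon>}"
    and "g m > 0"
  shows "left_end_finite_contribution Q \<longleftrightarrow> emeasure Q {m} > 0"
proof -
  note sets [measurable_cong] = assms(1)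
  have AE: "AE x in Q. m \<le> x"
    by (rule AE_ge_Inf_measure_support[OF assms(1,6)])
  have cont: "isCont g m"
    using assms(7) by (intro real_analytic_on_imp_isCont[OF assms(9)]) auto
  note down = can_params_downward_closed[OF sets AE]
  let ?R = "\<lambda>b. density Q (\<lambda>x. ennreal (exp (b * x)))"
  have point: "emeasure (?R b) {m} = ennreal (exp (b * m)) * emeasure Q {m}" for b
  proof -
    have "emeasure (?R b) {m} = (\<integral>\<^sup>+x. ennreal (exp (b * m)) * indicator {m} x \<partial>Q)"
      by (subst emeasure_density) (auto simp: sets intro!: nn_integral_cong split: split_indicator)
    then show ?thesis by (simp add: nn_integral_cmult_indicator sets)
  qed
  have fisher: "fisher_information Q \<beta> = fisher_information (?R b) (- (b - \<beta>))" for b \<beta>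
    by (simp add: fisher_information_density_exp[OF sets])
  obtain b\<^sub>0 where b\<^sub>0: "b\<^sub>0 \<in> can_params Q" using assms(4) by auto
  \<comment> \<open>Since \<open>Q\<close> is bounded on the left, its parameter space contains
    every real below one of its points.\<close>
  have "beta_inf Q = - \<infinity>"
  proof (rule ereal_bot)
    fix B :: real
    have "min B b\<^sub>0 \<in> can_params Q" by (rule down[OF b\<^sub>0]) simp
    then have "beta_inf Q \<le> ereal (min B b\<^sub>0)"
      unfolding beta_inf_def by (intro Inf_lower imageI)
    also have "\<dots> \<le> ereal B" by simp
    finally show "beta_inf Q \<le> ereal B" .
  qed
  then have J: "left_jeffreys_integral Q \<beta>\<^sub>1
      = (\<integral>\<^sup>+\<beta>. ennreal (sqrt (fisher_information Q \<beta>)) * indicator {..<\<beta>\<^sub>1} \<beta> \<partial>lborel)" for \<beta>\<^sub>1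
    by (simp add: left_jeffreys_integral_def)
  have "{..<b\<^sub>0} \<subseteq> interior (can_params Q)"
    using down[OF b\<^sub>0] by (intro interior_maximal) auto
  then have interior: "interior (can_params Q) \<noteq> {}"
    by (metis lessThan_non_empty subset_empty)
  have finite: "left_jeffreys_integral Q \<beta>\<^sub>1 < \<infinity>"
    if mass: "emeasure Q {m} > 0" and \<beta>\<^sub>1: "\<beta>\<^sub>1 \<in> interior (can_params Q)" for \<beta>\<^sub>1
  proof -
    obtain e where e: "e > 0" "ball \<beta>\<^sub>1 e \<subseteq> can_params Q"
      using \<beta>\<^sub>1 by (auto simp: mem_interior)
    \<comment> \<open>Tilting strictly to the right of \<open>\<beta>\<^sub>1\<close> keeps
      \<open>s = b - \<beta>\<close> above \<open>e / 2\<close>, away from 0, where the bound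
      \<open>s powr (- 1 - p / 2)\<close> fails to be integrable.\<close>
    define b where "b = \<beta>\<^sub>1 + e / 2"
    have b: "b \<in> can_params Q" "b > \<beta>\<^sub>1"
      using e by (auto simp: b_def dist_real_def intro!: subsetD[OF e(2)])
    obtain \<delta> c C where "power_like_left_end (?R b) m \<gamma> \<delta> c C"
      using power_like_left_end_density_exp[OF sets AE assms(3) b(1) assms(7,8) cont assms(10)] .
    then interpret power_like_left_end "?R b" m \<gamma> \<delta> c C .
    \<comment> \<open>The order of the negative moment already shown to be finite. The square root
      of the variance then decays like \<open>s powr (- 1 - p / 2)\<close>, with exponent below
      -1.\<close>
    define p where "p = \<gamma> / 2"
    have p: "p > 0" using \<gamma>_pos by (simp add: p_def)
    have "emeasure (?R b) {m} > 0"
      using mass by (simp add: point ennreal_zero_less_mult_iff)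
    from fisher_information_upper_bound[OF this p] nn_integral_negative_power_less_top
    obtain D where D: "D \<ge> 0" "\<And>s. s > 0 \<Longrightarrow> fisher_information (?R b) (- s) \<le> D * s powr (- (2 + p))"
      by (auto simp: p_def)
    have "left_jeffreys_integral Q \<beta>\<^sub>1
        \<le> (\<integral>\<^sup>+\<beta>. ennreal (sqrt D * (b - \<beta>) powr (- 1 - p / 2)) * indicator {..<\<beta>\<^sub>1} \<beta> \<partial>lborel)"
      unfolding J
    proof (rule nn_integral_mono)
      fix \<beta>
      have "sqrt (fisher_information Q \<beta>) \<le> sqrt D * (b - \<beta>) powr (- 1 - p / 2)" if "\<beta> < \<beta>\<^sub>1"
      proof -
        have "fisher_information Q \<beta> \<le> D * (b - \<beta>) powr (- (2 + p))"
          unfolding fisher[of \<beta> b] using that b by (intro D) auto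
        then have "sqrt (fisher_information Q \<beta>) \<le> sqrt (D * (b - \<beta>) powr (- (2 + p)))"
          by simp
        also have "\<dots> = sqrt D * ((b - \<beta>) powr (- (2 + p))) powr (1 / 2)"
          by (simp only: real_sqrt_mult powr_half_sqrt[OF powr_ge_zero])
        also have "((b - \<beta>) powr (- (2 + p))) powr (1 / 2) = (b - \<beta>) powr (- 1 - p / 2)"
          unfolding powr_powr by (rule arg_cong[of _ _ "(powr) (b - \<beta>)"]) simp
        finally show ?thesis .
      qed
      then show "ennreal (sqrt (fisher_information Q \<beta>)) * indicator {..<\<beta>\<^sub>1} \<beta>
          \<le> ennreal (sqrt D * (b - \<beta>) powr (- 1 - p / 2)) * indicator {..<\<beta>\<^sub>1} \<beta>"
        by (auto split: split_indicator intro: ennreal_leI)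
    qed
    also have "\<dots> = (\<integral>\<^sup>+s. ennreal (sqrt D * s powr (- 1 - p / 2)) * indicator {b - \<beta>\<^sub>1<..} s \<partial>lborel)"
      by (rule nn_integral_reflect_lessThan[where f = "\<lambda>s. ennreal (sqrt D * s powr (- 1 - p / 2))"]) measurable
    also have "\<dots> = ennreal (sqrt D) * (\<integral>\<^sup>+s. ennreal (s powr (- 1 - p / 2)) * indicator {b - \<beta>\<^sub>1<..} s \<partial>lborel)"
      using D by (subst nn_integral_cmult[symmetric]) (auto simp: ennreal_mult mult.assoc)
    also have "\<dots> < \<infinity>"
      using nn_integral_powr_at_top[of "p / 2" "b - \<beta>\<^sub>1"] p b by (simp add: ennreal_mult_less_top)
    finally show ?thesis .
  qed
  have infinite: "left_jeffreys_integral Q \<beta>\<^sub>1 = \<infinity>" if no_mass: "emeasure Q {m} = 0" for \<beta>\<^sub>1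
  proof -
    obtain \<delta> c C where "power_like_left_end (?R b\<^sub>0) m \<gamma> \<delta> c C"
      using power_like_left_end_density_exp[OF sets AE assms(3) b\<^sub>0 assms(7,8) cont assms(10)] .
    then interpret power_like_left_end "?R b\<^sub>0" m \<gamma> \<delta> c C .
    have "emeasure (?R b\<^sub>0) {m} = 0"
      using no_mass by (simp add: point)
    from fisher_information_lower_bound[OF this]
    obtain d where d: "d > 0" "\<And>s. s > 3 / \<delta> \<Longrightarrow> d / s\<^sup>2 \<le> fisher_information (?R b\<^sub>0) (- s)"
      by blast
    \<comment> \<open>For \<open>\<beta> < b\<^sub>0 - T\<close> the lower bound applies to
      \<open>s = b\<^sub>0 - \<beta>\<close>, and \<open>\<beta>\<close> lies in the range of
      integration below \<open>\<beta>\<^sub>1\<close>, whether or not \<open>b\<^sub>0\<close>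
      exceeds \<open>\<beta>\<^sub>1\<close>.\<close>
    define T where "T = max (3 / \<delta>) (b\<^sub>0 - \<beta>\<^sub>1)"
    have T: "T > 0" "3 / \<delta> \<le> T" "b\<^sub>0 - T \<le> \<beta>\<^sub>1" using \<delta>_pos by (auto simp: T_def less_max_iff_disj)
    have "\<infinity> = ennreal (sqrt d) * (\<integral>\<^sup>+s. ennreal (1 / s) * indicator {T<..} s \<partial>lborel)"
      using d T by (simp add: nn_integral_inverse_at_top ennreal_mult_top)
    \<comment> \<open>\<open>T\<close> is written as \<open>b\<^sub>0 - (b\<^sub>0 - T)\<close> to
      match the reflection formula applied next.\<close>
    also have "\<dots> = (\<integral>\<^sup>+s. ennreal (sqrt d * (1 / s)) * indicator {b\<^sub>0 - (b\<^sub>0 - T)<..} s \<partial>lborel)"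
      using d by (subst nn_integral_cmult[symmetric])
        (auto simp: ennreal_mult'[symmetric] mult.assoc[symmetric])
    also have "\<dots> = (\<integral>\<^sup>+\<beta>. ennreal (sqrt d * (1 / (b\<^sub>0 - \<beta>))) * indicator {..<b\<^sub>0 - T} \<beta> \<partial>lborel)"
      by (rule nn_integral_reflect_lessThan[where f = "\<lambda>s. ennreal (sqrt d * (1 / s))", symmetric]) measurable
    also have "\<dots> \<le> left_jeffreys_integral Q \<beta>\<^sub>1"
      unfolding J
    proof (rule nn_integral_mono)
      fix \<beta>
      have "sqrt d * (1 / (b\<^sub>0 - \<beta>)) \<le> sqrt (fisher_information Q \<beta>)" if "\<beta> < b\<^sub>0 - T"
      proof -
        have "sqrt d * (1 / (b\<^sub>0 - \<beta>)) = sqrt (d / (b\<^sub>0 - \<beta>)\<^sup>2)"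
          using that T by (simp add: real_sqrt_divide)
        also have "\<dots> \<le> sqrt (fisher_information Q \<beta>)"
          unfolding fisher[of \<beta> b\<^sub>0] real_sqrt_le_iff using that T by (intro d) auto
        finally show ?thesis .
      qed
      then show "ennreal (sqrt d * (1 / (b\<^sub>0 - \<beta>))) * indicator {..<b\<^sub>0 - T} \<beta>
          \<le> ennreal (sqrt (fisher_information Q \<beta>)) * indicator {..<\<beta>\<^sub>1} \<beta>"
        using T by (auto split: split_indicator intro: ennreal_leI)
    qed
    finally show ?thesis by (simp add: top_unique)
  qed
  \<comment> \<open>Without a point mass the integral diverges for every
    \<open>\<beta>\<^sub>1\<close>; the nonempty interior supplies one that contradicts
    finiteness.\<close>
  show ?thesis
    using finite infinite interior
    by (auto simp: left_end_finite_contribution_def zero_less_iff_neq_zero)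
qed

end
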